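(* Let $n\ge 1$, let $\lambda_1,\dots,\lambda_n\ge 0$ and $c\in\mathbb{R}$, let $x^{\alpha(1)},\dots,x^{\alpha(n)}$ be squared monomials in $n$ real variables $x=(x_1,\dots,x_n)$ of degree at most $2d$, and let $$p(x)=\Big(\sum_{i=1}^n \lambda_i x^{\alpha(i)}\Big)\Big(\sum_{i=1}^n \lambda_i \prod_{j\neq i} x^{\alpha(j)}\Big)-c\prod_{i=1}^n x^{\alpha(i)} =\sum_{1\le i<j\le n}\lambda_i\lambda_j\big(x^{2\alpha(i)}+x^{2\alpha(j)}\big)\prod_{k\ne i,j}x^{\alpha(k)}+\Big(\sum_{i=1}^n\lambda_i^2-c\Big)\prod_{i=1}^n x^{\alpha(i)}.$$ If $$K=\lambda_1^2+\cdots+\lambda_n^2-c\;\ge\;-2\sum_{1\le i<j\le n}\lambda_i\lambda_j,$$ then $p$ is a sum of squares of polynomials.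
   Context: A squared monomial is $x^{\alpha}=x_1^{\alpha_1}\cdots x_n^{\alpha_n}$ with all $\alpha_k$ even non-negative integers. The $x^{\alpha(i)}$ are not required to be distinct. A polynomial is a sum of squares (SOS) if it equals $\sum_{i=1}^r f_i^2$ for some real polynomials $f_i$. *)

theory Defs
  imports Complex_Main "HOL-Library.Poly_Mapping"
begin

text \<open>
  Real polynomials in countably many commuting variables: a polynomial maps exponent vectors
  (finitely supported functions from variable indices to exponents) to coefficients, with
  finite support. The ring operations are those of \<^theory>\<open>HOL-Library.Poly_Mapping\<close>, where
  multiplication is convolution. The polynomial ring in n variables is the subring of
  polynomials that only involve the variables with indices 1, ..., n.
\<close>

type_synonym expvec = "nat \<Rightarrow>\<^sub>0 nat"
type_synonym rpoly = "expvec \<Rightarrow>\<^sub>0 real"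

definition polys_in :: "nat \<Rightarrow> rpoly set" where
  "polys_in n = {p. \<forall>a \<in> Poly_Mapping.keys p. Poly_Mapping.keys a \<subseteq> {1..n}}"

definition Const :: "real \<Rightarrow> rpoly" where
  "Const c = Poly_Mapping.single 0 c"

definition Monom :: "expvec \<Rightarrow> rpoly" where
  "Monom a = Poly_Mapping.single a 1"

definition monom_degree :: "expvec \<Rightarrow> nat" where
  "monom_degree a = (\<Sum>k \<in> Poly_Mapping.keys a. Poly_Mapping.lookup a k)"

text \<open>Exponent vectors of squared monomials in the variables 1, ..., n.\<close>

definition squared_exponent :: "nat \<Rightarrow> expvec \<Rightarrow> bool" where
  "squared_exponent n a \<longleftrightarrow>
     Poly_Mapping.keys a \<subseteq> {1..n} \<and> (\<forall>k \<in> {1..n}. even (Poly_Mapping.lookup a k))"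

text \<open>The summands are required to be polynomials in the same n variables.\<close>

definition sos :: "nat \<Rightarrow> rpoly \<Rightarrow> bool" where
  "sos n p \<longleftrightarrow>
     (\<exists>(r::nat) f. (\<forall>i \<in> {1..r}. f i \<in> polys_in n) \<and> p = (\<Sum>i = 1..r. (f i)\<^sup>2))"

end

theory Submission
  imports Defs
begin

text \<open>
  Write \<open>m\<^sub>i\<close> for the \<open>i\<close>-th monomial and \<open>\<lambda>\<^sub>i\<close> for \<open>l i\<close>. In the product of the two linear combinations, the
  diagonal terms each give \<open>\<lambda>\<^sub>i\<^sup>2 \<Prod> m\<^sub>k\<close>, and the terms for \<open>(i, j)\<close> and \<open>(j, i)\<close> together give
  \<open>\<lambda>\<^sub>i \<lambda>\<^sub>j (m\<^sub>i\<^sup>2 + m\<^sub>j\<^sup>2)\<close> times the product of the other monomials; this is the identity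
  \<open>sum_times_sum_prod_except\<close>, valid in every commutative ring. Completing the squares
  (\<open>complete_squares_in_pair_sum\<close>) turns
  \<open>m\<^sub>i\<^sup>2 + m\<^sub>j\<^sup>2\<close> into \<open>(m\<^sub>i - m\<^sub>j)\<^sup>2 + 2 m\<^sub>i m\<^sub>j\<close>, so that
  \<open>p = (\<Sum>i<j. \<lambda>\<^sub>i \<lambda>\<^sub>j (m\<^sub>i - m\<^sub>j)\<^sup>2 \<Prod>k\<noteq>i,j. m\<^sub>k) + (K + 2 (\<Sum>i<j. \<lambda>\<^sub>i \<lambda>\<^sub>j)) \<Prod>k. m\<^sub>k\<close>.
  By hypothesis all scalar factors are nonnegative, hence squares of reals, and every \<open>m\<^sub>k\<close> is the
  square of the monomial with halved exponents (\<open>squared_monomial_is_square\<close>). So every summand is a square.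
\<close>

section \<open>Expanding the product in a commutative ring\<close>

lemma prod_extract_two:
  fixes m :: "'i \<Rightarrow> 'a::comm_monoid_mult"
  assumes "finite A" "i \<in> A" "j \<in> A" "i \<noteq> j"
  shows "(\<Prod>k\<in>A. m k) = m i * m j * (\<Prod>k\<in>A - {i, j}. m k)"
proof -
  have "(\<Prod>k\<in>A. m k) = m i * (\<Prod>k\<in>A - {i}. m k)"
    using assms by (simp add: prod.remove)
  also have "(\<Prod>k\<in>A - {i}. m k) = m j * (\<Prod>k\<in>A - {i} - {j}. m k)"
    using assms by (intro prod.remove) auto
  also have "A - {i} - {j} = A - {i, j}" by auto
  finally show ?thesis by (simp add: mult.assoc)
qed

lemma finite_increasing_pairs: "finite {(i, j). 1 \<le> i \<and> i < j \<and> j \<le> (n::nat)}"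
  by (rule finite_subset[of _ "{1..n} \<times> {1..n}"]) auto

text \<open>
  Swapping the indices maps the pairs below the diagonal onto those above it, so each
  increasing pair collects the two terms that differ by the swap.
\<close>

lemma sum_square_split_diagonal:
  fixes f :: "nat \<Rightarrow> nat \<Rightarrow> 'a::comm_monoid_add"
  shows "(\<Sum>i = 1..n. \<Sum>j = 1..n. f i j) =
    (\<Sum>(i, j) \<in> {(i, j). 1 \<le> i \<and> i < j \<and> j \<le> n}. f i j + f j i) + (\<Sum>i = 1..n. f i i)"
proof -
  let ?U = "{(i, j). 1 \<le> i \<and> i < j \<and> j \<le> n}"
  let ?L = "prod.swap ` ?U" and ?D = "(\<lambda>i. (i, i)) ` {1..n}"
  let ?g = "\<lambda>(i, j). f i j"
  have "(\<Sum>i = 1..n. \<Sum>j = 1..n. f i j) = sum ?g ({1..n} \<times> {1..n})"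
    by (simp add: sum.cartesian_product)
  also have "{1..n} \<times> {1..n} = (?U \<union> ?L) \<union> ?D"
    by (auto simp: image_iff)
  also have "sum ?g \<dots> = sum ?g (?U \<union> ?L) + sum ?g ?D"
    by (rule sum.union_disjoint) (use finite_increasing_pairs in auto)
  also have "sum ?g (?U \<union> ?L) = sum ?g ?U + sum ?g ?L"
    by (rule sum.union_disjoint) (use finite_increasing_pairs in auto)
  also have "sum ?g ?L = (\<Sum>(i, j) \<in> ?U. f j i)"
    by (subst sum.reindex) (auto intro!: sum.cong)
  also have "sum ?g ?D = (\<Sum>i = 1..n. f i i)"
    by (subst sum.reindex) (auto intro: inj_onI)
  finally show ?thesis
    by (simp add: sum.distrib split_def)
qed

text \<open>
  The term of the expanded product for \<open>i \<noteq> j\<close> is \<open>m i\<close> times a product that already contains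
  \<open>m i\<close> and lacks only \<open>m j\<close>. So \<open>m i\<close> occurs squared, and swapping \<open>i\<close> and \<open>j\<close> gives the partner
  with \<open>m j\<close> squared and the same remaining factors.
\<close>

lemma sum_times_sum_prod_except:
  fixes a m :: "nat \<Rightarrow> 'a::comm_ring_1"
  shows "(\<Sum>i = 1..n. a i * m i) * (\<Sum>i = 1..n. a i * (\<Prod>j \<in> {1..n} - {i}. m j)) =
    (\<Sum>(i, j) \<in> {(i, j). 1 \<le> i \<and> i < j \<and> j \<le> n}.
       a i * a j * ((m i)\<^sup>2 + (m j)\<^sup>2) * (\<Prod>k \<in> {1..n} - {i, j}. m k))
    + (\<Sum>i = 1..n. (a i)\<^sup>2) * (\<Prod>i = 1..n. m i)"
proof -
  let ?f = "\<lambda>i j. a i * m i * (a j * (\<Prod>k \<in> {1..n} - {j}. m k))"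
  have offdiag: "?f i j = a i * a j * (m i)\<^sup>2 * (\<Prod>k \<in> {1..n} - {i, j}. m k)"
    if "i \<in> {1..n}" "i \<noteq> j" for i j
  proof -
    have "(\<Prod>k \<in> {1..n} - {j}. m k) = m i * (\<Prod>k \<in> {1..n} - {j} - {i}. m k)"
      using that by (intro prod.remove) auto
    moreover have "{1..n} - {j} - {i} = {1..n} - {i, j}" by auto
    ultimately show ?thesis by (simp add: power2_eq_square mult_ac)
  qed
  have pair: "?f i j + ?f j i
      = a i * a j * ((m i)\<^sup>2 + (m j)\<^sup>2) * (\<Prod>k \<in> {1..n} - {i, j}. m k)"
    if "1 \<le> i \<and> i < j \<and> j \<le> n" for i j
    using offdiag[of i j] offdiag[of j i] that by (simp add: algebra_simps insert_commute)
  have diag: "?f i i = (a i)\<^sup>2 * (\<Prod>i = 1..n. m i)" if "i \<in> {1..n}" for i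
  proof -
    have "(\<Prod>i = 1..n. m i) = m i * (\<Prod>k \<in> {1..n} - {i}. m k)"
      using that by (intro prod.remove) auto
    then show ?thesis by (simp add: power2_eq_square mult_ac)
  qed
  have "(\<Sum>i = 1..n. a i * m i) * (\<Sum>i = 1..n. a i * (\<Prod>j \<in> {1..n} - {i}. m j))
      = (\<Sum>i = 1..n. \<Sum>j = 1..n. ?f i j)"
    by (rule sum_product)
  also have "\<dots> = (\<Sum>(i, j) \<in> {(i, j). 1 \<le> i \<and> i < j \<and> j \<le> n}. ?f i j + ?f j i)
      + (\<Sum>i = 1..n. ?f i i)"
    by (rule sum_square_split_diagonal)
  also have "(\<Sum>i = 1..n. ?f i i) = (\<Sum>i = 1..n. (a i)\<^sup>2) * (\<Prod>i = 1..n. m i)"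
    unfolding sum_distrib_right by (rule sum.cong) (use diag in auto)
  also have "(\<Sum>(i, j) \<in> {(i, j). 1 \<le> i \<and> i < j \<and> j \<le> n}. ?f i j + ?f j i)
      = (\<Sum>(i, j) \<in> {(i, j). 1 \<le> i \<and> i < j \<and> j \<le> n}.
       a i * a j * ((m i)\<^sup>2 + (m j)\<^sup>2) * (\<Prod>k \<in> {1..n} - {i, j}. m k))"
    by (rule sum.cong) (use pair in auto)
  finally show ?thesis .
qed

text \<open>
  The cross terms \<open>2 m\<^sub>i m\<^sub>j\<close> left over from completing the squares restore exactly the two
  factors missing from the product, so they all are multiples of the same full product.
\<close>

lemma complete_squares_in_pair_sum:
  fixes a m :: "nat \<Rightarrow> 'a::comm_ring_1"
  shows "(\<Sum>(i, j) \<in> {(i, j). 1 \<le> i \<and> i < j \<and> j \<le> n}.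
       a i * a j * ((m i)\<^sup>2 + (m j)\<^sup>2) * (\<Prod>k \<in> {1..n} - {i, j}. m k))
    = (\<Sum>(i, j) \<in> {(i, j). 1 \<le> i \<and> i < j \<and> j \<le> n}.
       a i * a j * (m i - m j)\<^sup>2 * (\<Prod>k \<in> {1..n} - {i, j}. m k))
    + 2 * (\<Sum>(i, j) \<in> {(i, j). 1 \<le> i \<and> i < j \<and> j \<le> n}. a i * a j) * (\<Prod>i = 1..n. m i)"
proof -
  let ?U = "{(i, j). 1 \<le> i \<and> i < j \<and> j \<le> n}"
  have "a i * a j * ((m i)\<^sup>2 + (m j)\<^sup>2) * (\<Prod>k \<in> {1..n} - {i, j}. m k)
      = a i * a j * (m i - m j)\<^sup>2 * (\<Prod>k \<in> {1..n} - {i, j}. m k)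
        + 2 * (a i * a j) * (\<Prod>i = 1..n. m i)"
    if "1 \<le> i \<and> i < j \<and> j \<le> n" for i j
  proof -
    have "(\<Prod>i = 1..n. m i) = m i * m j * (\<Prod>k \<in> {1..n} - {i, j}. m k)"
      using that by (intro prod_extract_two) auto
    then show ?thesis by (simp add: power2_eq_square algebra_simps)
  qed
  then have "(\<Sum>(i, j) \<in> ?U. a i * a j * ((m i)\<^sup>2 + (m j)\<^sup>2) * (\<Prod>k \<in> {1..n} - {i, j}. m k))
      = (\<Sum>(i, j) \<in> ?U. a i * a j * (m i - m j)\<^sup>2 * (\<Prod>k \<in> {1..n} - {i, j}. m k)
        + 2 * (a i * a j) * (\<Prod>i = 1..n. m i))"
    by (intro sum.cong) auto
  then show ?thesis
    by (simp add: split_def sum.distrib sum_distrib_left sum_distrib_right)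
qed

section \<open>Constants, monomials and polynomials in given variables\<close>

lemma Const_0 [simp]: "Const 0 = 0"
  by (simp add: Const_def)

lemma Const_add: "Const (a + b) = Const a + Const b"
  by (simp add: Const_def single_add)

lemma Const_diff: "Const (a - b) = Const a - Const b"
  by (simp add: Const_def single_diff)

lemma Const_mult: "Const (a * b) = Const a * Const b"
  by (simp add: Const_def mult_single)

lemma Const_power2: "Const (a\<^sup>2) = (Const a)\<^sup>2"
  by (simp add: power2_eq_square Const_mult)

lemma Const_sum: "Const (\<Sum>x\<in>A. f x) = (\<Sum>x\<in>A. Const (f x))"
  by (induction A rule: infinite_finite_induct) (auto simp: Const_add)

lemma Monom_add: "Monom (a + b) = Monom a * Monom b"
  by (simp add: Monom_def mult_single)

lemma Const_in_polys_in: "Const c \<in> polys_in n"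
  by (auto simp: polys_in_def Const_def)

lemma Monom_in_polys_in:
  "Poly_Mapping.keys a \<subseteq> {1..n} \<Longrightarrow> Monom a \<in> polys_in n"
  by (auto simp: polys_in_def Monom_def)

lemma one_in_polys_in: "1 \<in> polys_in n"
  by (auto simp: polys_in_def)

lemma diff_in_polys_in: "p \<in> polys_in n \<Longrightarrow> q \<in> polys_in n \<Longrightarrow> p - q \<in> polys_in n"
  using keys_diff[of p q] unfolding polys_in_def by blast

lemma mult_in_polys_in:
  assumes "p \<in> polys_in n" "q \<in> polys_in n"
  shows "p * q \<in> polys_in n"
  unfolding polys_in_def
proof safe
  fix c k
  assume "c \<in> Poly_Mapping.keys (p * q)" and k: "k \<in> Poly_Mapping.keys c"
  then obtain a b where "c = a + b" "a \<in> Poly_Mapping.keys p" "b \<in> Poly_Mapping.keys q"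
    using keys_mult[of p q] by blast
  then show "k \<in> {1..n}"
    using assms k Poly_Mapping.keys_add[of a b] unfolding polys_in_def by blast
qed

lemma prod_in_polys_in:
  "(\<And>x. x \<in> A \<Longrightarrow> f x \<in> polys_in n) \<Longrightarrow> (\<Prod>x\<in>A. f x) \<in> polys_in n"
  by (induction A rule: infinite_finite_induct) (auto intro: one_in_polys_in mult_in_polys_in)

text \<open>
  Only the variables \<open>1, ..., n\<close> are required to have even exponents, but all other exponents
  vanish, so halving loses nothing.
\<close>

lemma squared_monomial_is_square:
  assumes "squared_exponent n a"
  obtains \<mu> where "\<mu> \<in> polys_in n" "Monom a = \<mu>\<^sup>2"
proof
  define b where "b = Poly_Mapping.map (\<lambda>x. x div 2) a"
  have keys: "Poly_Mapping.keys b \<subseteq> Poly_Mapping.keys a"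
    by (auto simp: b_def in_keys_iff map.rep_eq when_def split: if_splits)
  then show "Monom b \<in> polys_in n"
    using assms by (intro Monom_in_polys_in) (auto simp: squared_exponent_def)
  have even: "even (Poly_Mapping.lookup a k)" for k
  proof (cases "k \<in> Poly_Mapping.keys a")
    case True
    then show ?thesis using assms by (auto simp: squared_exponent_def)
  next
    case False
    then show ?thesis by (simp add: in_keys_iff)
  qed
  have "a = b + b"
  proof (rule poly_mapping_eqI)
    fix k
    have "Poly_Mapping.lookup b k = Poly_Mapping.lookup a k div 2"
      by (simp add: b_def map.rep_eq when_def)
    then show "Poly_Mapping.lookup a k = Poly_Mapping.lookup (b + b) k"
      using even[of k] unfolding lookup_add by presburger
  qed
  then show "Monom a = (Monom b)\<^sup>2"
    by (metis Monom_add power2_eq_square)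
qed

section \<open>Sums of squares\<close>

lemma sos_square:
  assumes "q \<in> polys_in n"
  shows "sos n (q\<^sup>2)"
  unfolding sos_def by (rule exI[of _ 1], rule exI[of _ "\<lambda>_. q"]) (use assms in auto)

lemma square_add_sos:
  assumes "q \<in> polys_in n" "sos n p"
  shows "sos n (q\<^sup>2 + p)"
proof -
  obtain r :: nat and f where f: "\<forall>i \<in> {1..r}. f i \<in> polys_in n" "p = (\<Sum>i = 1..r. (f i)\<^sup>2)"
    using assms(2) unfolding sos_def by blast
  show ?thesis
    unfolding sos_def
  proof (intro exI conjI)
    show "\<forall>i \<in> {1..Suc r}. (f(Suc r := q)) i \<in> polys_in n"
      using f(1) assms(1) by auto
    show "q\<^sup>2 + p = (\<Sum>i = 1..Suc r. ((f(Suc r := q)) i)\<^sup>2)"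
      using f(2) by (simp add: add.commute)
  qed
qed

lemma sum_squares_add_sos:
  assumes "finite A" "\<And>x. x \<in> A \<Longrightarrow> g x \<in> polys_in n" "sos n p"
  shows "sos n ((\<Sum>x\<in>A. (g x)\<^sup>2) + p)"
  using assms by (induction A rule: finite_induct) (auto simp: add.assoc intro: square_add_sos)

section \<open>The polynomial as a sum of squares\<close>

theorem theorem2p5:
  fixes n d :: nat
    and l :: "nat \<Rightarrow> real"
    and c K :: real
    and \<alpha> :: "nat \<Rightarrow> expvec"
    and p :: rpoly
  assumes n: "n \<ge> 1"
    and l: "\<forall>i \<in> {1..n}. l i \<ge> 0"
    and squared: "\<forall>i \<in> {1..n}. squared_exponent n (\<alpha> i)"
    and degree: "\<forall>i \<in> {1..n}. monom_degree (\<alpha> i) \<le> 2 * d"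
    and p: "p = (\<Sum>i = 1..n. Const (l i) * Monom (\<alpha> i))
                * (\<Sum>i = 1..n. Const (l i) * (\<Prod>j \<in> {1..n} - {i}. Monom (\<alpha> j)))
              - Const c * (\<Prod>i = 1..n. Monom (\<alpha> i))"
    and K: "K = (\<Sum>i = 1..n. (l i)\<^sup>2) - c"
  shows "p = (\<Sum>(i, j) \<in> {(i, j). 1 \<le> i \<and> i < j \<and> j \<le> n}.
                Const (l i * l j) * ((Monom (\<alpha> i))\<^sup>2 + (Monom (\<alpha> j))\<^sup>2)
                  * (\<Prod>k \<in> {1..n} - {i, j}. Monom (\<alpha> k)))
             + Const ((\<Sum>i = 1..n. (l i)\<^sup>2) - c) * (\<Prod>i = 1..n. Monom (\<alpha> i))
       \<and> (K \<ge> - 2 * (\<Sum>(i, j) \<in> {(i, j). 1 \<le> i \<and> i < j \<and> j \<le> n}. l i * l j) \<longrightarrow> sos n p)"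
proof -
  define m where "m = (\<lambda>i. Monom (\<alpha> i))"
  define M where "M = (\<Prod>i = 1..n. m i)"
  let ?U = "{(i, j). 1 \<le> i \<and> i < j \<and> j \<le> n}"
  let ?R = "\<lambda>i j. \<Prod>k \<in> {1..n} - {i, j}. m k"
  have expand: "p = (\<Sum>(i, j) \<in> ?U. Const (l i * l j) * ((m i)\<^sup>2 + (m j)\<^sup>2) * ?R i j)
      + Const ((\<Sum>i = 1..n. (l i)\<^sup>2) - c) * M"
    unfolding p m_def[symmetric] M_def
    using sum_times_sum_prod_except[of "\<lambda>i. Const (l i)" m n]
    by (simp add: Const_mult Const_diff Const_sum Const_power2 m_def left_diff_distrib)
  have "sos n p" if nonneg: "K \<ge> - 2 * (\<Sum>(i, j) \<in> ?U. l i * l j)"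
  proof -
    (* e is the coefficient of the product of all monomials once the squares are completed. *)
    define e where "e = K + 2 * (\<Sum>(i, j) \<in> ?U. l i * l j)"
    have "e \<ge> 0" using nonneg by (simp add: e_def)
    have "\<exists>\<mu>. \<forall>i \<in> {1..n}. \<mu> i \<in> polys_in n \<and> m i = (\<mu> i)\<^sup>2"
      unfolding m_def by (rule bchoice) (metis squared squared_monomial_is_square)
    then obtain \<mu> where \<mu>: "\<mu> i \<in> polys_in n" "m i = (\<mu> i)\<^sup>2" if "i \<in> {1..n}" for i
      by blast
    have prod_m: "(\<Prod>k\<in>A. m k) = (\<Prod>k\<in>A. \<mu> k)\<^sup>2" if "A \<subseteq> {1..n}" for A
    proof -
      have "(\<Prod>k\<in>A. m k) = (\<Prod>k\<in>A. (\<mu> k)\<^sup>2)"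
        using that \<mu>(2) by (intro prod.cong) auto
      then show ?thesis by (simp add: prod_power_distrib)
    qed
    have prod_\<mu>: "(\<Prod>k\<in>A. \<mu> k) \<in> polys_in n" if "A \<subseteq> {1..n}" for A
      using that \<mu>(1) by (intro prod_in_polys_in) auto
    have m: "m i \<in> polys_in n" if "i \<in> {1..n}" for i
      using \<mu>[OF that] by (simp add: power2_eq_square mult_in_polys_in)
    define g where
      "g i j = Const (sqrt (l i * l j)) * (m i - m j) * (\<Prod>k \<in> {1..n} - {i, j}. \<mu> k)" for i j
    have g: "g i j \<in> polys_in n" if "(i, j) \<in> ?U" for i j
      unfolding g_def using that
      by (intro mult_in_polys_in diff_in_polys_in Const_in_polys_in prod_\<mu> m) auto
    have g_square: "Const (l i * l j) * (m i - m j)\<^sup>2 * ?R i j = (g i j)\<^sup>2"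
      if "(i, j) \<in> ?U" for i j
    proof -
      have "l i * l j \<ge> 0" using that l by auto
      then have "Const (l i * l j) = (Const (sqrt (l i * l j)))\<^sup>2"
        by (simp flip: Const_power2)
      then show ?thesis
        by (simp add: g_def power_mult_distrib prod_m)
    qed
    have two: "Const 2 = 2"
      using Const_add[of 1 1] by (simp add: Const_def)
    have rest: "Const e * M = (Const (sqrt e) * (\<Prod>k = 1..n. \<mu> k))\<^sup>2"
      using \<open>e \<ge> 0\<close> by (simp add: M_def prod_m power_mult_distrib flip: Const_power2)
    have "p = (\<Sum>(i, j) \<in> ?U. Const (l i * l j) * (m i - m j)\<^sup>2 * ?R i j) + Const e * M"
    proof -
      have "Const e = Const ((\<Sum>i = 1..n. (l i)\<^sup>2) - c)
          + 2 * (\<Sum>(i, j) \<in> ?U. Const (l i) * Const (l j))"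
        by (simp add: e_def K Const_add Const_mult Const_sum two split_def)
      then show ?thesis
        using complete_squares_in_pair_sum[of "\<lambda>i. Const (l i)" m n]
        unfolding expand M_def by (simp add: Const_mult distrib_right add_ac)
    qed
    also have "\<dots> = (\<Sum>x \<in> ?U. (case_prod g x)\<^sup>2) + (Const (sqrt e) * (\<Prod>k = 1..n. \<mu> k))\<^sup>2"
      unfolding rest using g_square by (intro arg_cong2[where f = "(+)"] sum.cong) auto
    also have "sos n \<dots>"
      by (intro sum_squares_add_sos sos_square finite_increasing_pairs mult_in_polys_in
          Const_in_polys_in prod_\<mu>) (use g in auto)
    finally show "sos n p" .
  qed
  with expand show ?thesis
    unfolding m_def M_def by blast
qed

end
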